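(* There is an $\mathsf{r}$-simple model $M$ such that: no $M$-predicate $H$ satisfies $\mathrm{False}_M^+=\Phi_M(H)\cap\mathrm{Sent}_M^+$ (F-Tarski$^+$ holds); no $M$-predicate $H$ satisfies $\Phi_M(H)=\mathrm{True}_M$ (T-Tarski holds); but some $M$-predicate $H$ satisfies $\mathrm{True}_M^+=\Phi_M(H)\cap\mathrm{Sent}_M^+$ (T-Tarski$^+$ fails).
   Context: For a non-empty set $\Sigma$ of symbols, $\Sigma^\ast$ is the set of all finite strings over $\Sigma$, including the empty string; $XY$ denotes concatenation. Fix distinct symbols $\mathsf{n},\mathsf{r},\sharp$. A simple model is a pair $M=(\Sigma_M,\Phi_M)$ where $\Sigma_M$ is a set of symbols with $\sharp\in\Sigma_M$, and, putting $\mathrm{Pred}_M=\{X\sharp : X\in\Sigma_M^\ast \text{ and } X \text{ does not contain } \sharp\}$, $\Phi_M$ is a function $\mathrm{Pred}_M\to\mathcal{P}(\Sigma_M^\ast)$. Elements of $\mathrm{Pred}_M$ are called $M$-predicates. $\mathrm{Sent}_M=\{HX : H\in\mathrm{Pred}_M, X\in\Sigma_M^\ast\}$ is the set of $M$-sentences (the decomposition $HX$ is unique), and $\mathrm{Sent}_M^+=\mathrm{Sent}_M\setminus\mathrm{Pred}_M$. $\mathrm{True}_M=\{HX\in\mathrm{Sent}_M : H\in\mathrm{Pred}_M, X\in\Phi_M(H)\}$, $\mathrm{True}_M^+=\mathrm{True}_M\cap\mathrm{Sent}_M^+$, $\mathrm{False}_M^+=\mathrm{Sent}_M^+\setminus\mathrm{True}_M^+$.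 A simple model $M$ is an $\mathsf{r}$-simple model if $\mathsf{r}\in\Sigma_M$ and for each $H\in\mathrm{Pred}_M$ we have $\mathsf{r}H\in\mathrm{Pred}_M$ and $\Phi_M(\mathsf{r}H)=\{K\in\mathrm{Pred}_M : KK\in\Phi_M(H)\}$. *)

theory Defs
  imports Main "HOL-Library.FuncSet"
begin

text \<open>Symbols are the elements of an arbitrary type, strings are lists. The fixed symbols
  \<open>\<sharp>\<close> and \<open>r\<close> are the explicit parameters \<open>sharp\<close> and \<open>r\<close>.\<close>

record 'a smodel =
  Sigma_of :: "'a set"
  Phi :: "'a list \<Rightarrow> 'a list set"

definition Pred :: "'a \<Rightarrow> 'a smodel \<Rightarrow> 'a list set" where
  "Pred sharp M = {X @ [sharp] | X. X \<in> lists (Sigma_of M) \<and> sharp \<notin> set X}"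

text \<open>\<open>\<rightarrow>\<^sub>E\<close> makes \<open>Phi M\<close> a function on \<open>Pred sharp M\<close> proper: outside that domain it takes the
  fixed dummy value \<open>undefined\<close>.\<close>

definition simple_model :: "'a \<Rightarrow> 'a smodel \<Rightarrow> bool" where
  "simple_model sharp M \<longleftrightarrow>
     sharp \<in> Sigma_of M \<and> Phi M \<in> Pred sharp M \<rightarrow>\<^sub>E Pow (lists (Sigma_of M))"

definition Sent :: "'a \<Rightarrow> 'a smodel \<Rightarrow> 'a list set" where
  "Sent sharp M = {H @ X | H X. H \<in> Pred sharp M \<and> X \<in> lists (Sigma_of M)}"

definition Sent_plus :: "'a \<Rightarrow> 'a smodel \<Rightarrow> 'a list set" where
  "Sent_plus sharp M = Sent sharp M - Pred sharp M"

definition True_sents :: "'a \<Rightarrow> 'a smodel \<Rightarrow> 'a list set" where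
  "True_sents sharp M =
     {H @ X | H X. H @ X \<in> Sent sharp M \<and> H \<in> Pred sharp M \<and> X \<in> Phi M H}"

definition True_plus :: "'a \<Rightarrow> 'a smodel \<Rightarrow> 'a list set" where
  "True_plus sharp M = True_sents sharp M \<inter> Sent_plus sharp M"

definition False_plus :: "'a \<Rightarrow> 'a smodel \<Rightarrow> 'a list set" where
  "False_plus sharp M = Sent_plus sharp M - True_plus sharp M"

definition r_simple_model :: "'a \<Rightarrow> 'a \<Rightarrow> 'a smodel \<Rightarrow> bool" where
  "r_simple_model r sharp M \<longleftrightarrow>
     simple_model sharp M \<and> r \<in> Sigma_of M \<and>
     (\<forall>H \<in> Pred sharp M.
        r # H \<in> Pred sharp M \<and>
        Phi M (r # H) = {K \<in> Pred sharp M. K @ K \<in> Phi M H})"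

definition F_Tarski_plus :: "'a \<Rightarrow> 'a smodel \<Rightarrow> bool" where
  "F_Tarski_plus sharp M \<longleftrightarrow>
     \<not> (\<exists>H \<in> Pred sharp M. False_plus sharp M = Phi M H \<inter> Sent_plus sharp M)"

definition T_Tarski :: "'a \<Rightarrow> 'a smodel \<Rightarrow> bool" where
  "T_Tarski sharp M \<longleftrightarrow> \<not> (\<exists>H \<in> Pred sharp M. Phi M H = True_sents sharp M)"

definition T_Tarski_plus :: "'a \<Rightarrow> 'a smodel \<Rightarrow> bool" where
  "T_Tarski_plus sharp M \<longleftrightarrow>
     \<not> (\<exists>H \<in> Pred sharp M. True_plus sharp M = Phi M H \<inter> Sent_plus sharp M)"

end

theory Submission
  imports Defs
begin

text \<open>Let \<open>\<sharp>\<close> hold of the empty string only, and let every other predicate hold of nothing.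
  The only true sentence is then \<open>\<sharp>\<close> itself, which is a predicate; so there are no true sentences in
  \<open>Sent\<^sup>+\<close>, and every predicate defines this empty set there. No predicate defines
  the set \<open>{\<sharp>}\<close> of truths, nor the nonempty set of falsehoods in \<open>Sent\<^sup>+\<close>. The model is
  \<open>r\<close>-simple because \<open>KK\<close> is never empty, so that \<open>rH\<close> must hold of nothing.\<close>

definition empty_string_model :: "'a \<Rightarrow> 'a smodel" where
  "empty_string_model sharp =
     \<lparr>Sigma_of = UNIV,
      Phi = restrict (\<lambda>H. if H = [sharp] then {[]} else {}) {X @ [sharp] | X. sharp \<notin> set X}\<rparr>"

text \<open>The domain of \<open>Phi\<close> is spelled out in the model because \<open>Pred\<close>
  takes the finished model as argument. Over the alphabet \<open>UNIV\<close> the two sets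
  agree.\<close>

lemma Pred_empty_string_model:
  "Pred sharp (empty_string_model sharp) = {X @ [sharp] | X. sharp \<notin> set X}"
  by (simp add: Pred_def empty_string_model_def)

lemma Phi_empty_string_model:
  assumes "H \<in> Pred sharp (empty_string_model sharp)"
  shows "Phi (empty_string_model sharp) H = (if H = [sharp] then {[]} else {})"
  using assms unfolding Pred_empty_string_model by (simp add: empty_string_model_def)

lemma Cons_in_Pred_empty_string_model:
  assumes "a \<noteq> sharp" and "H \<in> Pred sharp (empty_string_model sharp)"
  shows "a # H \<in> Pred sharp (empty_string_model sharp)"
proof -
  obtain X where "H = X @ [sharp]" "sharp \<notin> set X"
    using assms(2) by (auto simp: Pred_empty_string_model)
  then have "a # H = (a # X) @ [sharp]" "sharp \<notin> set (a # X)"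
    using assms(1) by auto
  then show ?thesis unfolding Pred_empty_string_model by blast
qed

lemma sharp_in_Pred_empty_string_model: "[sharp] \<in> Pred sharp (empty_string_model sharp)"
  by (simp add: Pred_empty_string_model)

lemma append_in_Sent_empty_string_model:
  assumes "H \<in> Pred sharp (empty_string_model sharp)"
  shows "H @ X \<in> Sent sharp (empty_string_model sharp)"
proof -
  have "X \<in> lists (Sigma_of (empty_string_model sharp))"
    by (simp add: empty_string_model_def)
  with assms show ?thesis
    unfolding Sent_def by (intro CollectI exI conjI) (rule refl)
qed

lemma r_simple_empty_string_model:
  assumes "r \<noteq> sharp"
  shows "r_simple_model r sharp (empty_string_model sharp)"
proof -
  let ?M = "empty_string_model sharp"
  have Nil: "[] \<notin> Pred sharp ?M"
    by (simp add: Pred_empty_string_model)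
  have "Phi ?M \<in> Pred sharp ?M \<rightarrow>\<^sub>E Pow (lists (Sigma_of ?M))"
    unfolding Pred_empty_string_model by (auto simp: empty_string_model_def)
  \<comment> \<open>Both sides are empty: \<open>r # H\<close> differs from \<open>[sharp]\<close>
    because \<open>r \<noteq> sharp\<close>, and \<open>K @ K = []\<close> would make
    \<open>[]\<close> a predicate.\<close>
  moreover have "Phi ?M (r # H) = {K \<in> Pred sharp ?M. K @ K \<in> Phi ?M H}"
    if H: "H \<in> Pred sharp ?M" for H
    using Nil assms
    by (auto simp: Phi_empty_string_model[OF H]
        Phi_empty_string_model[OF Cons_in_Pred_empty_string_model[OF assms H]])
  ultimately show ?thesis
    using Cons_in_Pred_empty_string_model[OF assms]
    by (auto simp: r_simple_model_def simple_model_def empty_string_model_def)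
qed

lemma True_sents_empty_string_model:
  "True_sents sharp (empty_string_model sharp) = {[sharp]}"
proof
  let ?M = "empty_string_model sharp"
  show "True_sents sharp ?M \<subseteq> {[sharp]}"
    by (auto simp: True_sents_def Phi_empty_string_model split: if_splits)
  have "[] \<in> Phi ?M [sharp]"
    by (simp add: Phi_empty_string_model sharp_in_Pred_empty_string_model)
  then have "[sharp] @ [] \<in> True_sents sharp ?M"
    unfolding True_sents_def
    using sharp_in_Pred_empty_string_model
      append_in_Sent_empty_string_model[OF sharp_in_Pred_empty_string_model]
    by (intro CollectI exI conjI) (rule refl)
  then show "{[sharp]} \<subseteq> True_sents sharp ?M"
    by simp
qed

lemma True_plus_empty_string_model: "True_plus sharp (empty_string_model sharp) = {}"
  using sharp_in_Pred_empty_string_model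
  by (auto simp: True_plus_def True_sents_empty_string_model Sent_plus_def)

text \<open>A predicate holds at most of \<open>[]\<close>, and \<open>[]\<close> is not a sentence,
  since every sentence contains \<open>sharp\<close>.\<close>

lemma Phi_Int_Sent_plus_empty_string_model:
  assumes "H \<in> Pred sharp (empty_string_model sharp)"
  shows "Phi (empty_string_model sharp) H \<inter> Sent_plus sharp (empty_string_model sharp) = {}"
  by (auto simp: Phi_empty_string_model[OF assms] Sent_plus_def Sent_def Pred_empty_string_model)

lemma False_plus_empty_string_model: "False_plus sharp (empty_string_model sharp) \<noteq> {}"
proof -
  let ?M = "empty_string_model sharp"
  \<comment> \<open>The witness is \<open>[sharp]\<close> applied to itself: it contains
    \<open>sharp\<close> twice, a predicate only once.\<close>
  have "[sharp] @ [sharp] \<in> Sent sharp ?M"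
    using sharp_in_Pred_empty_string_model by (rule append_in_Sent_empty_string_model)
  moreover have "[sharp] @ [sharp] \<notin> Pred sharp ?M"
    unfolding Pred_empty_string_model by (auto simp: Cons_eq_append_conv)
  ultimately show ?thesis
    by (auto simp: False_plus_def True_plus_empty_string_model Sent_plus_def)
qed

theorem proposition4p7:
  fixes n r sharp :: 'a
  assumes "distinct [n, r, sharp]"
  shows "\<exists>M :: 'a smodel.
           r_simple_model r sharp M \<and>
           F_Tarski_plus sharp M \<and>
           T_Tarski sharp M \<and>
           \<not> T_Tarski_plus sharp M"
proof (intro exI conjI)
  let ?M = "empty_string_model sharp"
  show "r_simple_model r sharp ?M"
    using assms by (simp add: r_simple_empty_string_model)
  show "F_Tarski_plus sharp ?M"
    using False_plus_empty_string_model[of sharp]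
    by (auto simp: F_Tarski_plus_def Phi_Int_Sent_plus_empty_string_model)
  \<comment> \<open>Every value of \<open>Phi\<close> on predicates is \<open>{[]}\<close> or
    \<open>{}\<close>, never \<open>{[sharp]}\<close>.\<close>
  show "T_Tarski sharp ?M"
    by (auto simp: T_Tarski_def True_sents_empty_string_model Phi_empty_string_model)
  show "\<not> T_Tarski_plus sharp ?M"
    \<comment> \<open>Any predicate would serve as witness here; \<open>[sharp]\<close> is one at
      hand.\<close>
    using sharp_in_Pred_empty_string_model[of sharp]
    by (auto simp: T_Tarski_plus_def True_plus_empty_string_model
        Phi_Int_Sent_plus_empty_string_model)
qed

end
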